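(* Let $G=(V,E)$ be a finite, connected, undirected, unweighted graph with shortest-path distance $d$. Under distributed embedding (a set of landmarks $\mathbf{L}\subseteq V$ and an assignment $\lambda:V\to\mathbf{L}$ of each vertex to a landmark), the dual landmark heuristic $\pi_t^{DL}$ is not consistent: consistency $\pi_t^{DL}(v)\le c(v,v')+\pi_t^{DL}(v')$ for every edge $(v,v')\in E$, where $c(v,v')$ is the cost of the edge, does not hold in general.
   Context: Distributed embedding: a set of landmark vertices $\mathbf{L}\subseteq V$ is chosen and the vertex set is partitioned so that every vertex $v$ is assigned to exactly one landmark $\lambda(v)\in\mathbf{L}$; only the distances $d(v,\lambda(v))$ for each $v$ and the pairwise distances $d(l,l')$ for $l,l'\in\mathbf{L}$ are stored. For a target $t$ and visited vertex $v$, put $l_1=\lambda(v)$ and $l_2=\lambda(t)$, and define $\pi_t^{DL}(v,1)=|d(v,l_1)-d(l_1,l_2)|-d(l_2,t)$, $\pi_t^{DL}(v,2)=|d(v,l_1)-d(l_2,t)|-d(l_1,l_2)$, $\pi_t^{DL}(v,3)=|d(l_1,l_2)-d(l_2,t)|-d(v,l_1)$, $\pi_t^{DL}(v,6)=\dfrac{|d(v,l_1)-d(l_1,l_2)|\cdot|d(l_1,l_2)-d(l_2,t)|-d(v,l_1)\cdot d(l_2,t)}{d(l_1,l_2)}$ (only when $l_1\neq l_2$), and, only when $l_1=l_2$, $\pi_t^{DL}(v,4)=|d(v,l_1)-d(l_1,t)|$ and $\pi_t^{DL}(v,5)=|d(v,l_2)-d(l_2,t)|$. The heuristic is $\pi_t^{DL}(v)=\max_i\pi_t^{DL}(v,i)$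 over the defined terms. A heuristic $h$ is consistent (monotone) if $h(v)\le c(v,v')+h(v')$ for every edge $(v,v')$, where $c(v,v')\ge 0$ is the transition cost (here $1$, as the graph is unweighted). *)

theory Defs
  imports "Graph_Theory.Graph_Theory"
begin

definition unit_cost :: "('a \<times> 'a) weight_fun" where
  "unit_cost = (\<lambda>_. 1)"

text \<open>The library's shortest-walk cost takes values in the extended reals; in a connected graph
  with unit costs it is finite, so the conversion to a real loses nothing.\<close>

definition graph_dist :: "'a pair_pre_digraph \<Rightarrow> 'a \<Rightarrow> 'a \<Rightarrow> real" where
  "graph_dist G u v = real_of_ereal (wf_digraph.\<mu> (with_proj G) unit_cost u v)"

definition distributed_embedding :: "'a pair_pre_digraph \<Rightarrow> 'a set \<Rightarrow> ('a \<Rightarrow> 'a) \<Rightarrow> bool" where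
  "distributed_embedding G L lam \<longleftrightarrow> L \<subseteq> pverts G \<and> (\<forall>v \<in> pverts G. lam v \<in> L)"

definition DL1 :: "('a \<Rightarrow> 'a \<Rightarrow> real) \<Rightarrow> ('a \<Rightarrow> 'a) \<Rightarrow> 'a \<Rightarrow> 'a \<Rightarrow> real" where
  "DL1 d lam t v = (let l1 = lam v; l2 = lam t in \<bar>d v l1 - d l1 l2\<bar> - d l2 t)"

definition DL2 :: "('a \<Rightarrow> 'a \<Rightarrow> real) \<Rightarrow> ('a \<Rightarrow> 'a) \<Rightarrow> 'a \<Rightarrow> 'a \<Rightarrow> real" where
  "DL2 d lam t v = (let l1 = lam v; l2 = lam t in \<bar>d v l1 - d l2 t\<bar> - d l1 l2)"

definition DL3 :: "('a \<Rightarrow> 'a \<Rightarrow> real) \<Rightarrow> ('a \<Rightarrow> 'a) \<Rightarrow> 'a \<Rightarrow> 'a \<Rightarrow> real" where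
  "DL3 d lam t v = (let l1 = lam v; l2 = lam t in \<bar>d l1 l2 - d l2 t\<bar> - d v l1)"

definition DL4 :: "('a \<Rightarrow> 'a \<Rightarrow> real) \<Rightarrow> ('a \<Rightarrow> 'a) \<Rightarrow> 'a \<Rightarrow> 'a \<Rightarrow> real" where
  "DL4 d lam t v = (let l1 = lam v in \<bar>d v l1 - d l1 t\<bar>)"

definition DL5 :: "('a \<Rightarrow> 'a \<Rightarrow> real) \<Rightarrow> ('a \<Rightarrow> 'a) \<Rightarrow> 'a \<Rightarrow> 'a \<Rightarrow> real" where
  "DL5 d lam t v = (let l2 = lam t in \<bar>d v l2 - d l2 t\<bar>)"

definition DL6 :: "('a \<Rightarrow> 'a \<Rightarrow> real) \<Rightarrow> ('a \<Rightarrow> 'a) \<Rightarrow> 'a \<Rightarrow> 'a \<Rightarrow> real" where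
  "DL6 d lam t v = (let l1 = lam v; l2 = lam t in
     (\<bar>d v l1 - d l1 l2\<bar> * \<bar>d l1 l2 - d l2 t\<bar> - d v l1 * d l2 t) / d l1 l2)"

text \<open>The bounds 4 and 5 need a distance to a landmark shared by \<open>v\<close> and \<open>t\<close>, while 6 has the
  denominator \<open>d l1 l2\<close>; the maximum ranges over the bounds that are defined.\<close>

definition DL_heuristic :: "('a \<Rightarrow> 'a \<Rightarrow> real) \<Rightarrow> ('a \<Rightarrow> 'a) \<Rightarrow> 'a \<Rightarrow> 'a \<Rightarrow> real" where
  "DL_heuristic d lam t v =
     Max ({DL1 d lam t v, DL2 d lam t v, DL3 d lam t v} \<union>
          (if lam v = lam t then {DL4 d lam t v, DL5 d lam t v} else {DL6 d lam t v}))"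

text \<open>The arc set of an undirected graph is symmetric, so each edge is taken in both directions.\<close>

definition consistent :: "'a pair_pre_digraph \<Rightarrow> ('a \<times> 'a) weight_fun \<Rightarrow> ('a \<Rightarrow> real) \<Rightarrow> bool" where
  "consistent G c h \<longleftrightarrow> (\<forall>(v, v') \<in> parcs G. h v \<le> c (v, v') + h v')"

end

theory Submission
  imports Defs
begin

text \<open>The bounds see \<open>t\<close> from \<open>v\<close> only through the landmark of \<open>v\<close>, so their quality may
  change abruptly along an edge whose endpoints have different landmarks. On the path
  \<open>0 - 1 - 2 - 3\<close> with target \<open>0\<close>, let \<open>0\<close>, \<open>1\<close> and \<open>3\<close> be landmarks, each assigned to itself,
  and assign \<open>2\<close> to \<open>1\<close>. Then \<open>3\<close> gets its exact distance \<open>3\<close> to the target, whereas \<open>2\<close> gets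
  \<open>0\<close> because it and the target are equally far from \<open>1\<close>.\<close>

text \<open>The parameter counts edges, so there is one more vertex.\<close>

definition path_graph :: "nat \<Rightarrow> nat pair_pre_digraph" where
  "path_graph n = \<lparr>pverts = {..n},
     parcs = {(i, j). i \<le> n \<and> j \<le> n \<and> (j = Suc i \<or> i = Suc j)}\<rparr>"

lemma pverts_path_graph [simp]: "pverts (path_graph n) = {..n}"
  by (simp add: path_graph_def)

lemma parcs_path_graph [simp]:
  "(i, j) \<in> parcs (path_graph n) \<longleftrightarrow> i \<le> n \<and> j \<le> n \<and> (j = Suc i \<or> i = Suc j)"
  by (simp add: path_graph_def)

lemma pair_graph_path_graph: "pair_graph (path_graph n)"
proof unfold_locales
  have "parcs (path_graph n) \<subseteq> {..n} \<times> {..n}"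
    by auto
  then show "finite (parcs (path_graph n))"
    by (rule finite_subset) simp
qed (auto simp: symmetric_def sym_def)

interpretation path_graph: pair_graph "path_graph n" for n
  by (rule pair_graph_path_graph)

lemma awalk_cost_unit_cost:
  fixes p :: "(nat \<times> nat) list"
  shows "wf_digraph.awalk_cost unit_cost p = real (length p)"
  \<comment> \<open>The cost of a walk refers to no graph, so the facts for an arbitrary path graph
    apply.\<close>
  by (induction p) (simp_all add: path_graph.awalk_cost_Nil path_graph.awalk_cost_Cons unit_cost_def)

text \<open>Each arc changes the vertex number by exactly one; the triangle inequality does the
  rest.\<close>

lemma path_graph_awalk_length_ge:
  assumes "path_graph.awalk n u p v"
  shows "\<bar>real u - real v\<bar> \<le> real (length p)"
  using assms
proof (induction p arbitrary: u)
  case Nil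
  then show ?case
    by (simp add: path_graph.awalk_Nil_iff)
next
  case (Cons e p)
  obtain w where "(u, w) \<in> parcs (path_graph n)" "path_graph.awalk n w p v"
    using Cons.prems by (cases e) (auto simp: path_graph.awalk_Cons_iff)
  moreover from this(2) have "\<bar>real w - real v\<bar> \<le> real (length p)"
    by (rule Cons.IH)
  ultimately show ?case
    by auto
qed

lemma path_graph_awalk_upward:
  assumes "u \<le> v" "v \<le> n"
  shows "\<exists>p. path_graph.awalk n u p v \<and> length p = v - u"
  using assms
\<comment> \<open>The induction descends from \<open>v\<close>, so that each step prepends one
  arc.\<close>
proof (induction u rule: inc_induct)
  case base
  then show ?case
    by (auto intro!: exI[of _ "[]"] simp: path_graph.awalk_Nil_iff)
next
  case (step u)
  then obtain p where "path_graph.awalk n (Suc u) p v" "length p = v - Suc u"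
    by blast
  with step show ?case
    by (intro exI[of _ "(u, Suc u) # p"]) (simp add: path_graph.awalk_Cons_iff Suc_diff_Suc)
qed

lemma length_rev_path [simp]: "length (rev_path p) = length p"
  by (induction p) simp_all

lemma path_graph_awalk:
  assumes "u \<le> n" "v \<le> n"
  obtains p where "path_graph.awalk n u p v" "real (length p) = \<bar>real u - real v\<bar>"
proof (cases "u \<le> v")
  case True
  then obtain p where "path_graph.awalk n u p v" "length p = v - u"
    using path_graph_awalk_upward assms by blast
  with True that show ?thesis
    by simp
next
  case False
  then obtain p where "path_graph.awalk n v p u" "length p = u - v"
    using path_graph_awalk_upward[of v u n] assms by auto
  \<comment> \<open>Reversing an upward walk is allowed because the arc set is symmetric.\<close>
  with False that[of "rev_path p"] show ?thesis
    by simp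
qed

lemma connected_path_graph: "connected (with_proj (path_graph n))"
  unfolding connected_def
proof (rule strongly_connectedI)
  fix u v assume "u \<in> verts (mk_symmetric (with_proj (path_graph n)))"
    "v \<in> verts (mk_symmetric (with_proj (path_graph n)))"
  then obtain p where "path_graph.awalk n u p v"
    using path_graph_awalk[of u n v] by auto
  then have "u \<rightarrow>\<^sup>*\<^bsub>with_proj (path_graph n)\<^esub> v"
    by (rule path_graph.reachable_awalkI)
  then show "u \<rightarrow>\<^sup>*\<^bsub>mk_symmetric (with_proj (path_graph n))\<^esub> v"
    \<comment> \<open>Connectedness is defined through the symmetric closure, which adds no arcs
      here.\<close>
    by (simp only: path_graph.reachable_mk_symmetric_eq[OF path_graph.sym_arcs])
qed auto

text \<open>The infimum over walk costs is bounded below by the length estimate and attained by a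
  monotone walk.\<close>

lemma graph_dist_path_graph:
  assumes "u \<le> n" "v \<le> n"
  shows "graph_dist (path_graph n) u v = \<bar>real u - real v\<bar>"
proof -
  obtain p where p: "path_graph.awalk n u p v" "real (length p) = \<bar>real u - real v\<bar>"
    using assms by (rule path_graph_awalk)
  have "path_graph.\<mu> n unit_cost u v = ereal \<bar>real u - real v\<bar>"
  proof (rule antisym)
    show "path_graph.\<mu> n unit_cost u v \<le> ereal \<bar>real u - real v\<bar>"
      using path_graph.min_cost_le_walk_cost[OF p(1), of unit_cost] p(2)
      by (simp add: awalk_cost_unit_cost)
    show "ereal \<bar>real u - real v\<bar> \<le> path_graph.\<mu> n unit_cost u v"
      unfolding path_graph.\<mu>_def
      by (rule INF_greatest) (simp add: awalk_cost_unit_cost path_graph_awalk_length_ge)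
  qed
  then show ?thesis
    by (simp add: graph_dist_def)
qed

theorem theorem2:
  shows "\<not> (\<forall>(G :: nat pair_pre_digraph) L lam t.
    pair_graph G \<longrightarrow> connected (with_proj G) \<longrightarrow>
    distributed_embedding G L lam \<longrightarrow> t \<in> pverts G \<longrightarrow>
    consistent G unit_cost (DL_heuristic (graph_dist G) lam t))"
proof
  let ?G = "path_graph 3" and ?lam = "id(2 := 1) :: nat \<Rightarrow> nat"
  let ?h = "DL_heuristic (graph_dist ?G) ?lam 0"
  assume "\<forall>(G :: nat pair_pre_digraph) L lam t.
    pair_graph G \<longrightarrow> connected (with_proj G) \<longrightarrow>
    distributed_embedding G L lam \<longrightarrow> t \<in> pverts G \<longrightarrow>
    consistent G unit_cost (DL_heuristic (graph_dist G) lam t)"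
  moreover have "distributed_embedding ?G {0, 1, 3} ?lam"
    by (auto simp: distributed_embedding_def)
  ultimately have "consistent ?G unit_cost ?h"
    using pair_graph_path_graph connected_path_graph by simp
  moreover have "(3, 2) \<in> parcs ?G"
    by simp
  ultimately have "?h 3 \<le> 1 + ?h 2"
    by (fastforce simp: consistent_def unit_cost_def)
  \<comment> \<open>Neither 3 nor 2 shares its landmark with the target, so bounds 1, 2, 3 and 6
    compete: they are 3, -3, 3, 3 at vertex 3 and all 0 at vertex 2.\<close>
  moreover have "?h 3 = 3" "?h 2 = 0"
    by (simp_all add: DL_heuristic_def DL1_def DL2_def DL3_def DL6_def graph_dist_path_graph)
  ultimately show False
    by simp
qed

end
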